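(* Let $f:\mathbb{R}^M\to\mathbb{R}$ be a black-box regression function possessing derivatives of arbitrary order, and let $F(\bm{x},y)=f(\bm{x})-y$ be the deviation function. Let $(\bm{x}^t,y^t)\in\mathbb{R}^M\times\mathbb{R}$ be a test sample, and let $P(\bm{x})$ be the probability distribution of the input variables on $\mathbb{R}^M$. Then the (conditional expectation) Shapley value applied to $F$ is deviation-agnostic: for every $i\in\{1,\ldots,M\}$, $$\mathrm{SV}_i(\bm{x}^t,y^t)=\mathrm{SV}_i(\bm{x}^t),$$ where the right-hand side is the Shapley value of $f$ itself. In particular, $\mathrm{SV}_i(\bm{x}^t,y^t+\Delta)=\mathrm{SV}_i(\bm{x}^t,y^t)$ for every $\Delta\in\mathbb{R}$.
   Context: An anomaly attribution method $A$, which assigns to each function $f$, test sample $(\bm{x}^t,y^t)$ and input-variable index $i$ a score $A_{f,i}(\bm{x}^t,y^t)$, is called deviation-agnostic if for any $f$, $(\bm{x}^t,y^t)$, $\Delta\in\mathbb{R}$ and $i$ one has $A_{f,i}(\bm{x}^t,y^t)=A_{f,i}(\bm{x}^t,y^t+\Delta)$. For $i\in\{1,\ldots,M\}$, let $\mathcal{S}_i$ denote a subset of $\{1,\ldots,M\}\setminus\{i\}$, and let $\bar{\mathcal{S}}_i=\{1,\ldots,M\}\setminus(\{i\}\cup\mathcal{S}_i)$; correspondingly write $\bm{x}=(x_i,\bm{x}_{\mathcal{S}_i},\bm{x}_{\bar{\mathcal{S}}_i})$. The Shapley value of the deviation function is $$\mathrm{SV}_i(\bm{x}^t,y^t)=\frac{1}{M}\sum_{k=0}^{M-1}\binom{M-1}{k}^{-1}\sum_{\mathcal{S}_i:\,|\mathcal{S}_i|=k}\Delta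 f(\mathcal{S}_i),\qquad \Delta f(\mathcal{S}_i)=\langle F\mid x_i^t,\bm{x}_{\mathcal{S}_i}^t,y^t\rangle-\langle F\mid\bm{x}_{\mathcal{S}_i}^t,y^t\rangle.$$ Here $\langle F\mid x_i^t,\bm{x}_{\mathcal{S}_i}^t,y^t\rangle$ is the expected value of $F$ with $(x_i,\bm{x}_{\mathcal{S}_i},y)$ fixed at $(x_i^t,\bm{x}_{\mathcal{S}_i}^t,y^t)$ and $\bm{x}_{\bar{\mathcal{S}}_i}$ integrated out, that is, $$\int P(\bm{x}_{\bar{\mathcal{S}}_i}\mid x_i^t,\bm{x}_{\mathcal{S}_i}^t)\,F\bigl((x_i^t,\bm{x}_{\mathcal{S}_i}^t,\bm{x}_{\bar{\mathcal{S}}_i}),y^t\bigr)\,\mathrm{d}\bm{x}_{\bar{\mathcal{S}}_i},$$ and $\langle F\mid\bm{x}_{\mathcal{S}_i}^t,y^t\rangle$ is the expected value of $F$ with $(\bm{x}_{\mathcal{S}_i},y)$ fixed at $(\bm{x}_{\mathcal{S}_i}^t,y^t)$ and $(x_i,\bm{x}_{\bar{\mathcal{S}}_i})$ integrated out, that is, $$\int P(x_i,\bm{x}_{\bar{\mathcal{S}}_i}\mid\bm{x}_{\mathcal{S}_i}^t)\,F\bigl((x_i,\bm{x}_{\mathcal{S}_i}^t,\bm{x}_{\bar{\mathcal{S}}_i}),y^t\bigr)\,\mathrm{d}x_i\,\mathrm{d}\bm{x}_{\bar{\mathcal{S}}_i}.$$ If no variables remain to be integrated out, the expectation is the value of the function.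 The conditional distributions are those of $P(\bm{x})$; $y$ is simply set to $y^t$ as an argument of $F$. All these conditional expectations are assumed to exist and be finite. The Shapley value $\mathrm{SV}_i(\bm{x}^t)$ of $f$ is defined by the same formula with $\Delta f(\mathcal{S}_i)=\langle f\mid x_i^t,\bm{x}_{\mathcal{S}_i}^t\rangle-\langle f\mid\bm{x}_{\mathcal{S}_i}^t\rangle$, where the expectations are taken with respect to the same conditional distributions of $\bm{x}$. *)

theory Defs
  imports "HOL-Probability.Probability"
begin

text \<open>
  The input variables are indexed by a finite type, so that \<open>real ^ 'n\<close> is the input space,
  with dimension \<open>M = CARD('n)\<close>.
\<close>

fun higher_differentiable ::
  "('a::real_normed_vector \<Rightarrow> 'b::real_normed_vector) \<Rightarrow> nat \<Rightarrow> bool" where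
  "higher_differentiable f 0 \<longleftrightarrow> continuous_on UNIV f"
| "higher_differentiable f (Suc n) \<longleftrightarrow>
     (\<forall>x. f differentiable (at x)) \<and>
     (\<forall>v. higher_differentiable (\<lambda>x. frechet_derivative f (at x) v) n)"

definition smooth :: "('a::real_normed_vector \<Rightarrow> 'b::real_normed_vector) \<Rightarrow> bool" where
  "smooth f \<longleftrightarrow> (\<forall>n. higher_differentiable f n)"

definition deviation :: "('x \<Rightarrow> real) \<Rightarrow> 'x \<Rightarrow> real \<Rightarrow> real" where
  "deviation f x y = f x - y"

definition sub_vec :: "'n set \<Rightarrow> real ^ 'n \<Rightarrow> 'n \<Rightarrow> real" where
  "sub_vec S x = restrict (($) x) S"

definition merge_vec :: "'n set \<Rightarrow> real ^ 'n \<Rightarrow> ('n \<Rightarrow> real) \<Rightarrow> real ^ 'n" where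
  "merge_vec S x z = (\<chi> j. if j \<in> S then x $ j else z j)"

text \<open>
  A choice, for every set \<open>S\<close> of conditioning variables, of a regular conditional distribution
  of the remaining variables given those in \<open>S\<close>: a Markov kernel \<open>K S\<close> satisfying the
  disintegration identity with respect to \<open>P\<close>.  A distribution without a density is allowed.
  Such kernels are unique only up to null sets, so the version is kept as a parameter.
\<close>
definition conditional_distributions ::
  "(real ^ 'n) measure \<Rightarrow> ('n set \<Rightarrow> ('n \<Rightarrow> real) \<Rightarrow> ('n \<Rightarrow> real) measure) \<Rightarrow> bool" where
  "conditional_distributions P K \<longleftrightarrow>
     (\<forall>S. K S \<in> (\<Pi>\<^sub>M j\<in>S. borel) \<rightarrow>\<^sub>M prob_algebra (\<Pi>\<^sub>M j\<in>- S. borel) \<and>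
       (\<forall>A \<in> sets (\<Pi>\<^sub>M j\<in>S. borel). \<forall>B \<in> sets (\<Pi>\<^sub>M j\<in>- S. borel).
          emeasure P {x \<in> space P. sub_vec S x \<in> A \<and> sub_vec (- S) x \<in> B} =
          (\<integral>\<^sup>+ x. indicator A (sub_vec S x) * emeasure (K S (sub_vec S x)) B \<partial>P)))"

text \<open>The expected value of \<open>g\<close> with the variables in \<open>S\<close> fixed at their values in \<open>x\<close>.\<close>
definition cond_expect ::
  "('n set \<Rightarrow> ('n \<Rightarrow> real) \<Rightarrow> ('n \<Rightarrow> real) measure) \<Rightarrow> (real ^ 'n \<Rightarrow> real) \<Rightarrow> 'n set \<Rightarrow> real ^ 'n \<Rightarrow> real"
  where
  "cond_expect K g S x =
     (if S = UNIV then g x else (\<integral> z. g (merge_vec S x z) \<partial>K S (sub_vec S x)))"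

definition cond_expects_exist ::
  "('n set \<Rightarrow> ('n \<Rightarrow> real) \<Rightarrow> ('n \<Rightarrow> real) measure) \<Rightarrow> (real ^ 'n \<Rightarrow> real) \<Rightarrow> real ^ 'n \<Rightarrow> bool"
  where
  "cond_expects_exist K g x \<longleftrightarrow>
     (\<forall>S. S \<noteq> UNIV \<longrightarrow> integrable (K S (sub_vec S x)) (\<lambda>z. g (merge_vec S x z)))"

definition shapley ::
  "('n::finite set \<Rightarrow> ('n \<Rightarrow> real) \<Rightarrow> ('n \<Rightarrow> real) measure) \<Rightarrow>
   (real ^ 'n \<Rightarrow> real) \<Rightarrow> 'n \<Rightarrow> real ^ 'n \<Rightarrow> real" where
  "shapley K g i x =
     1 / real CARD('n) *
     (\<Sum>k = 0..CARD('n) - 1. inverse (real ((CARD('n) - 1) choose k)) *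
        (\<Sum>S | S \<subseteq> UNIV - {i} \<and> card S = k.
           cond_expect K g (insert i S) x - cond_expect K g S x))"

definition shapley_deviation ::
  "('n::finite set \<Rightarrow> ('n \<Rightarrow> real) \<Rightarrow> ('n \<Rightarrow> real) measure) \<Rightarrow>
   (real ^ 'n \<Rightarrow> real) \<Rightarrow> 'n \<Rightarrow> real ^ 'n \<Rightarrow> real \<Rightarrow> real" where
  "shapley_deviation K f i x y = shapley K (\<lambda>u. deviation f u y) i x"

text \<open>
  The predicate \<open>D f x y\<close> delimits the inputs on which the attribution method \<open>A\<close> is defined;
  HOL functions being total, \<open>A\<close> has junk values elsewhere.
\<close>
definition deviation_agnostic ::
  "(('x \<Rightarrow> real) \<Rightarrow> 'x \<Rightarrow> real \<Rightarrow> bool) \<Rightarrow> (('x \<Rightarrow> real) \<Rightarrow> 'i \<Rightarrow> 'x \<Rightarrow> real \<Rightarrow> real) \<Rightarrow> bool" where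
  "deviation_agnostic D A \<longleftrightarrow>
     (\<forall>f x y \<Delta> i. D f x y \<longrightarrow> A f i x y = A f i x (y + \<Delta>))"

end

theory Submission imports Defs begin

text \<open>
  Conditional distributions are probability measures, so subtracting the constant \<open>y\<close> from \<open>f\<close>
  lowers every conditional expectation by exactly \<open>y\<close>; this cancels in each of the differences
  that make up the Shapley value.
\<close>

text \<open>Measurability into \<open>prob_algebra\<close> constrains the kernel at every point of
  its domain, not merely almost everywhere, so the claim holds at any individual sample.\<close>

lemma conditional_distributions_prob_space:
  assumes "conditional_distributions P K"
  shows "prob_space (K S (sub_vec S x))"
proof -
  have "K S \<in> (\<Pi>\<^sub>M j\<in>S. borel) \<rightarrow>\<^sub>M prob_algebra (\<Pi>\<^sub>M j\<in>- S. borel)"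
    using assms by (simp add: conditional_distributions_def)
  moreover have "sub_vec S x \<in> space (\<Pi>\<^sub>M j\<in>S. borel)"
    by (simp add: sub_vec_def space_PiM)
  ultimately have "K S (sub_vec S x) \<in> space (prob_algebra (\<Pi>\<^sub>M j\<in>- S. borel))"
    by (rule measurable_space)
  then show ?thesis
    by (simp add: space_prob_algebra)
qed

lemma cond_expect_deviation:
  assumes "conditional_distributions P K"
    and "cond_expects_exist K (\<lambda>u. deviation f u y) x"
  shows "cond_expect K (\<lambda>u. deviation f u y) S x = cond_expect K f S x - y"
proof (cases "S = UNIV")
  \<comment> \<open>The full set does occur in the Shapley sum, as \<open>insert i S\<close> for the
    largest coalition; no kernel enters there.\<close>
  case True
  then show ?thesis by (simp add: cond_expect_def deviation_def)
next
  case False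
  interpret prob_space "K S (sub_vec S x)"
    by (rule conditional_distributions_prob_space[OF assms(1)])
  have "integrable (K S (sub_vec S x)) (\<lambda>z. f (merge_vec S x z) - y)"
    using assms(2) False by (simp add: cond_expects_exist_def deviation_def)
  \<comment> \<open>Existence is assumed for the deviation only. Adding back the constant,
    integrable against a probability measure, gives integrability of \<open>f\<close>, so that the
    integral splits; total mass 1 then turns the integral of \<open>y\<close> into
    \<open>y\<close>.\<close>
  from Bochner_Integration.integrable_add[OF this integrable_const[of y]]
  have "integrable (K S (sub_vec S x)) (\<lambda>z. f (merge_vec S x z))"
    by simp
  then show ?thesis
    using False by (simp add: cond_expect_def deviation_def prob_space)
qed

lemma shapley_deviation_eq_shapley:
  assumes "conditional_distributions P K"
    and "cond_expects_exist K (\<lambda>u. deviation f u y) x"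
  shows "shapley_deviation K f i x y = shapley K f i x"
  by (simp add: shapley_deviation_def shapley_def cond_expect_deviation[OF assms])

text \<open>Lets existence at \<open>y\<close> alone suffice for comparing the Shapley values at
  \<open>y\<close> and \<open>y + \<Delta>\<close>.\<close>

lemma cond_expects_exist_deviation_shift:
  assumes "conditional_distributions P K"
    and "cond_expects_exist K (\<lambda>u. deviation f u y) x"
  shows "cond_expects_exist K (\<lambda>u. deviation f u (y + \<Delta>)) x"
  unfolding cond_expects_exist_def
proof (intro allI impI)
  fix S :: "'a set"
  assume "S \<noteq> UNIV"
  interpret prob_space "K S (sub_vec S x)"
    by (rule conditional_distributions_prob_space[OF assms(1)])
  have "integrable (K S (sub_vec S x)) (\<lambda>z. deviation f (merge_vec S x z) y)"
    using assms(2) \<open>S \<noteq> UNIV\<close> by (simp add: cond_expects_exist_def)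
  from Bochner_Integration.integrable_diff[OF this integrable_const[of \<Delta>]]
  show "integrable (K S (sub_vec S x)) (\<lambda>z. deviation f (merge_vec S x z) (y + \<Delta>))"
    by (simp add: deviation_def algebra_simps)
qed

lemma shapley_deviation_shift:
  assumes "conditional_distributions P K"
    and "cond_expects_exist K (\<lambda>u. deviation f u y) x"
  shows "shapley_deviation K f i x (y + \<Delta>) = shapley_deviation K f i x y"
  using shapley_deviation_eq_shapley[OF assms]
    shapley_deviation_eq_shapley[OF assms(1) cond_expects_exist_deviation_shift[OF assms]]
  by simp

theorem theorem3:
  fixes f :: "real ^ 'n \<Rightarrow> real"
    and P :: "(real ^ 'n) measure"
    and K :: "'n set \<Rightarrow> ('n \<Rightarrow> real) \<Rightarrow> ('n \<Rightarrow> real) measure"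
    and x :: "real ^ 'n" and y :: real
  assumes "smooth f"
    and "prob_space P" and "sets P = sets borel"
    and "conditional_distributions P K"
    and "cond_expects_exist K (\<lambda>u. deviation f u y) x"
  shows "(\<forall>i. shapley_deviation K f i x y = shapley K f i x) \<and>
         (\<forall>i \<Delta>. shapley_deviation K f i x (y + \<Delta>) = shapley_deviation K f i x y) \<and>
         deviation_agnostic
           (\<lambda>g u v. smooth g \<and> cond_expects_exist K (\<lambda>w. deviation g w v) u)
           (shapley_deviation K)"
  \<comment> \<open>The last conjunct ranges over all functions and samples, so the shift lemma is
    also supplied with only the kernel assumption discharged; existence then comes from the domain
    predicate.\<close>
  unfolding deviation_agnostic_def
  using shapley_deviation_eq_shapley[OF assms(4,5)] shapley_deviation_shift[OF assms(4,5)]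
    shapley_deviation_shift[OF assms(4)]
  by simp

end
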